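(* Let $M>0$. Let $F_0$ be a distribution function which has a continuous strictly positive density $f_0$ on $[0,M]$, where $f_0$ stays away from zero, and let $(U,V)$ be the order statistics ($U<V$) of an absolutely continuous distribution. Assume that $(U,V)$ has a positive continuous density $h$ on $$S=\{(u,v):0\le u<v\le M\},$$ staying away from zero, and with bounded partial derivatives. Let $(X_i,U_i,V_i)$, $i=1,2,\dots$, be i.i.d., where $X_i$ has distribution function $F_0$, $(U_i,V_i)$ is distributed as $(U,V)$, and $X_i$ is independent of $(U_i,V_i)$. Put $\Delta_{i0}=1_{\{X_i\le U_i\}}$, $\Delta_{i1}=1_{\{U_i<X_i\le V_i\}}$ and $\Delta_{i2}=1-\Delta_{i0}-\Delta_{i1}$. Let $\hat F_n$ be the isotonic least squares estimator, minimizing $$\sum_{i=1}^n\Bigl\{\{F(U_i)-\Delta_{i0}\}^2+\{F(V_i)-F(U_i)-\Delta_{i1}\}^2+\{1-F(V_i)-\Delta_{i2}\}^2\Bigr\}$$ over all distribution functions $F$. Then $\hat F_n$ converges almost surely to $F_0$ in the supremum metric, i.e. $\sup_t|\hat F_n(t)-F_0(t)|\to0$ almost surely as $n\to\infty$.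
   Context: Interval censoring, case 2: the $X_i$ are not observed; one observes only $(U_i,V_i,\Delta_{i0},\Delta_{i1})$, $i=1,\dots,n$. The distribution with distribution function $F_0$ is concentrated on $[0,M]$. "Stays away from zero" means bounded below by a strictly positive constant. The criterion depends on $F$ only through its values at the points $U_i,V_i$; as a convention, $\hat F_n$ is taken to be a right-continuous step function that is constant between successive observation points (order statistics of the set of all $U_i$'s and $V_i$'s) and zero to the left of the smallest one. *)

theory Defs
  imports "HOL-Probability.Probability"
begin

definition distribution_function :: "(real \<Rightarrow> real) \<Rightarrow> bool" where
  "distribution_function F \<longleftrightarrow>
     mono F \<and> (\<forall>t. continuous (at_right t) F) \<and> (F \<longlongrightarrow> 0) at_bot \<and> (F \<longlongrightarrow> 1) at_top"

(* The Lebesgue-Stieltjes measure of F has density f on A and no mass outside A. *)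
definition has_density_on :: "(real \<Rightarrow> real) \<Rightarrow> (real \<Rightarrow> real) \<Rightarrow> real set \<Rightarrow> bool" where
  "has_density_on F f A \<longleftrightarrow>
     interval_measure F = density lborel (\<lambda>x. ennreal (f x * indicator A x))"

definition stays_away_from_zero_on :: "('b \<Rightarrow> real) \<Rightarrow> 'b set \<Rightarrow> bool" where
  "stays_away_from_zero_on f A \<longleftrightarrow> (\<exists>c>0. \<forall>x\<in>A. c \<le> f x)"

(* The library's indep_var requires both variables to have values in the same type. *)
definition indep_rv :: "'a measure \<Rightarrow> 'b measure \<Rightarrow> ('a \<Rightarrow> 'b) \<Rightarrow> 'c measure \<Rightarrow> ('a \<Rightarrow> 'c) \<Rightarrow> bool" where
  "indep_rv P S X T Y \<longleftrightarrow>
     X \<in> measurable P S \<and> Y \<in> measurable P T \<and>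
     prob_space.indep_set P {X -` A \<inter> space P |A. A \<in> sets S} {Y -` B \<inter> space P |B. B \<in> sets T}"

definition obs_domain :: "real \<Rightarrow> (real \<times> real) set" where
  "obs_domain M = {(u, v). 0 \<le> u \<and> u < v \<and> v \<le> M}"

(* Derivatives are relative to A, hence one-sided where A ends in the given direction. *)
definition bounded_partial_derivatives_on :: "(real \<times> real \<Rightarrow> real) \<Rightarrow> (real \<times> real) set \<Rightarrow> bool" where
  "bounded_partial_derivatives_on h A \<longleftrightarrow>
     (\<exists>h1 h2 B. \<forall>u v. (u, v) \<in> A \<longrightarrow>
        ((\<lambda>x. h (x, v)) has_real_derivative h1 u v) (at u within {x. (x, v) \<in> A}) \<and>
        ((\<lambda>y. h (u, y)) has_real_derivative h2 u v) (at v within {y. (u, y) \<in> A}) \<and>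
        \<bar>h1 u v\<bar> \<le> B \<and> \<bar>h2 u v\<bar> \<le> B)"

definition Delta0 :: "real \<Rightarrow> real \<Rightarrow> real \<Rightarrow> real" where
  "Delta0 x u v = of_bool (x \<le> u)"

definition Delta1 :: "real \<Rightarrow> real \<Rightarrow> real \<Rightarrow> real" where
  "Delta1 x u v = of_bool (u < x \<and> x \<le> v)"

definition Delta2 :: "real \<Rightarrow> real \<Rightarrow> real \<Rightarrow> real" where
  "Delta2 x u v = 1 - Delta0 x u v - Delta1 x u v"

definition ls_criterion ::
  "nat \<Rightarrow> (nat \<Rightarrow> real) \<Rightarrow> (nat \<Rightarrow> real) \<Rightarrow> (nat \<Rightarrow> real) \<Rightarrow> (real \<Rightarrow> real) \<Rightarrow> real" where
  "ls_criterion n x u v F =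
     (\<Sum>i=1..n. (F (u i) - Delta0 (x i) (u i) (v i))\<^sup>2
             + (F (v i) - F (u i) - Delta1 (x i) (u i) (v i))\<^sup>2
             + (1 - F (v i) - Delta2 (x i) (u i) (v i))\<^sup>2)"

definition obs_points :: "nat \<Rightarrow> (nat \<Rightarrow> real) \<Rightarrow> (nat \<Rightarrow> real) \<Rightarrow> real set" where
  "obs_points n u v = u ` {1..n} \<union> v ` {1..n}"

(* F is zero to the left of the smallest point of T and constant between successive points;
   nothing is prescribed to the right of the largest one, where a minimiser of the
   criterion may still be below 1. *)
definition step_on :: "real set \<Rightarrow> (real \<Rightarrow> real) \<Rightarrow> bool" where
  "step_on T F \<longleftrightarrow>
     (\<forall>t. (\<forall>p\<in>T. t < p) \<longrightarrow> F t = 0) \<and>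
     (\<forall>a\<in>T. \<forall>b\<in>T. T \<inter> {a<..<b} = {} \<longrightarrow> (\<forall>t\<in>{a..<b}. F t = F a))"

definition isotonic_lse ::
  "nat \<Rightarrow> (nat \<Rightarrow> real) \<Rightarrow> (nat \<Rightarrow> real) \<Rightarrow> (nat \<Rightarrow> real) \<Rightarrow> (real \<Rightarrow> real) \<Rightarrow> bool" where
  "isotonic_lse n x u v F \<longleftrightarrow>
     distribution_function F \<and>
     (\<forall>G. distribution_function G \<longrightarrow> ls_criterion n x u v F \<le> ls_criterion n x u v G) \<and>
     step_on (obs_points n u v) F"

end

theory Submission
  imports Defs
begin

text \<open>
  The proof is the classical basic-inequality argument.  Write \<open>D\<close> for the difference of the
  estimator and \<open>F0\<close>, and \<open>r\<^sub>i t\<close> for the centred indicator of \<open>X\<^sub>i \<le> t\<close>.  Since the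
  estimator does at least as well as \<open>F0\<close> in the least squares criterion, completing the square
  (\<open>basic_inequality\<close>) bounds the mean of the squares of \<open>D (U\<^sub>i)\<close> by twice the mean of
  \<open>D (U\<^sub>i) * (2 * r\<^sub>i (U\<^sub>i) - r\<^sub>i (V\<^sub>i)) + D (V\<^sub>i) * (2 * r\<^sub>i (V\<^sub>i) - r\<^sub>i (U\<^sub>i))\<close>.

  For a fixed function in place of \<open>D\<close> this would be a mean of independent bounded variables with
  expectation \<open>0\<close>, because the \<open>r\<^sub>i\<close> are centred given \<open>(U\<^sub>i, V\<^sub>i)\<close>
  (\<open>expectation_weighted_residual_eq_0\<close>).  The estimator depends on the sample, so a uniform
  statement is required.  It comes from monotonicity: \<open>D\<close> is a difference of two monotone
  functions with values in \<open>{0..1}\<close>, and for such functions weighted means are controlled by their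
  restrictions to finitely many short intervals, uniformly in the function
  (\<open>monotone_weighted_mean_tendsto_0\<close>); this uses that the distributions of \<open>U\<close> and \<open>V\<close> have no
  atoms.  It therefore suffices that the strong law (\<open>strong_law_bounded\<close>) holds simultaneously
  for indicators of intervals with rational end points, with and without residual weights.

  Hence almost surely the mean of the squares of \<open>D (U\<^sub>i)\<close> tends to \<open>0\<close>.  Every interval inside
  \<open>{0..M}\<close> receives a positive fraction of the points \<open>U\<^sub>i\<close>, so by monotonicity and continuity of
  \<open>F0\<close> the estimator converges at every point (\<open>LIMSEQ_of_mean_square_deviation\<close>), and by Polya's
  theorem (\<open>uniform_limit_distribution_function\<close>) it converges uniformly.
\<close>

section \<open>Sample means and a strong law for bounded variables\<close>

definition sample_mean :: "(nat \<Rightarrow> real) \<Rightarrow> nat \<Rightarrow> real" where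
  "sample_mean y n = (\<Sum>i=1..n. y i) / real n"

lemma sample_mean_cong: "(\<And>i. i \<ge> 1 \<Longrightarrow> f i = g i) \<Longrightarrow> sample_mean f n = sample_mean g n"
  by (simp add: sample_mean_def)

lemma sample_mean_diff: "sample_mean (\<lambda>i. f i - g i) n = sample_mean f n - sample_mean g n"
  by (simp add: sample_mean_def sum_subtractf diff_divide_distrib)

lemma sample_mean_add: "sample_mean (\<lambda>i. f i + g i) n = sample_mean f n + sample_mean g n"
  by (simp add: sample_mean_def sum.distrib add_divide_distrib)

lemma sample_mean_cmult: "sample_mean (\<lambda>i. c * f i) n = c * sample_mean f n"
  by (simp add: sample_mean_def sum_distrib_left)

lemma sample_mean_sum: "sample_mean (\<lambda>i. \<Sum>j\<in>J. f j i) n = (\<Sum>j\<in>J. sample_mean (f j) n)"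
  unfolding sample_mean_def by (subst sum.swap) (simp add: sum_divide_distrib)

lemma sample_mean_mono: "(\<And>i. i \<ge> 1 \<Longrightarrow> f i \<le> g i) \<Longrightarrow> sample_mean f n \<le> sample_mean g n"
  unfolding sample_mean_def by (intro divide_right_mono sum_mono) auto

lemma abs_sample_mean_le: "\<bar>sample_mean f n\<bar> \<le> sample_mean (\<lambda>i. \<bar>f i\<bar>) n"
  by (simp add: sample_mean_def abs_divide divide_right_mono sum_abs)

text \<open>
  By Hoeffding's inequality, the probability that the mean of $n$ variables misses \<open>\<mu>\<close> by \<open>\<epsilon>\<close>
  decays geometrically in $n$, hence is summable, and Borel--Cantelli applies.
\<close>

lemma (in prob_space) strong_law_bounded:
  fixes Y :: "nat \<Rightarrow> 'a \<Rightarrow> real"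
  assumes indep: "indep_vars (\<lambda>_. borel) Y {1..}"
    and bound: "\<And>i \<omega>. i \<ge> 1 \<Longrightarrow> \<omega> \<in> space M \<Longrightarrow> \<bar>Y i \<omega>\<bar> \<le> B"
    and mean: "\<And>i. i \<ge> 1 \<Longrightarrow> expectation (Y i) = \<mu>"
  shows "AE \<omega> in M. sample_mean (\<lambda>i. Y i \<omega>) \<longlonglongrightarrow> \<mu>"
proof -
  define C where "C = \<bar>B\<bar> + 1"
  have C: "C > 0" "\<And>i \<omega>. i \<ge> 1 \<Longrightarrow> \<omega> \<in> space M \<Longrightarrow> Y i \<omega> \<in> {-C..C}"
    using bound by (auto simp: C_def abs_le_iff, smt (verit), smt (verit))
  have [measurable]: "Y i \<in> borel_measurable M" if "i \<ge> 1" for i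
    using indep that by (auto simp: indep_vars_def)
  have eventually_close: "AE \<omega> in M. eventually (\<lambda>n. \<bar>sample_mean (\<lambda>i. Y i \<omega>) n - \<mu>\<bar> < \<epsilon>) sequentially"
    if \<epsilon>: "\<epsilon> > 0" for \<epsilon>
  proof -
    define A where "A n = {\<omega> \<in> space M. \<bar>(\<Sum>i=1..n. Y i \<omega>) - real n * \<mu>\<bar> \<ge> real n * \<epsilon>}" for n
    have [measurable]: "A n \<in> sets M" for n
      unfolding A_def by measurable
    (* 2 * q ^ n is the Hoeffding bound at deviation n * \<epsilon> for variables with range {-C..C}. *)
    define q where "q = exp (- (\<epsilon>\<^sup>2 / (2 * C\<^sup>2)))"
    have q: "0 < q" "q < 1"
      using \<epsilon> C by (auto simp: q_def)
    have le: "prob (A n) \<le> 2 * q ^ n" for n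
    proof (cases "n = 0")
      case True
      have "prob (A 0) \<le> 1" by simp
      also have "1 \<le> 2 * q ^ 0" by simp
      finally show ?thesis using True by simp
    next
      case False
      interpret Hoeffding_ineq M "{1..n}" Y "\<lambda>_. -C" "\<lambda>_. C" "\<Sum>i=1..n. expectation (Y i)"
      proof unfold_locales
        show "indep_vars (\<lambda>_. borel) Y {1..n}"
          by (rule indep_vars_subset[OF indep]) auto
        show "AE x in M. Y i x \<in> {-C..C}" if "i \<in> {1..n}" for i
          using C(2) that by (intro AE_I2) auto
      qed auto
      have sq: "(\<Sum>i=1..n. (C - (-C))\<^sup>2) = real n * (2 * C)\<^sup>2"
        by simp
      have "prob {\<omega> \<in> space M. \<bar>(\<Sum>i=1..n. Y i \<omega>) - (\<Sum>i=1..n. expectation (Y i))\<bar> \<ge> real n * \<epsilon>}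
              \<le> 2 * exp (-2 * (real n * \<epsilon>)\<^sup>2 / (\<Sum>i=1..n. (C - (-C))\<^sup>2))"
        by (rule Hoeffding_ineq_abs_ge) (use False C \<epsilon> in auto)
      also have "(\<Sum>i=1..n. expectation (Y i)) = real n * \<mu>"
        by (simp add: mean)
      also have "-2 * (real n * \<epsilon>)\<^sup>2 / (\<Sum>i=1..n. (C - (-C))\<^sup>2) = real n * (- (\<epsilon>\<^sup>2 / (2 * C\<^sup>2)))"
        unfolding sq using False C by (simp add: field_simps power2_eq_square)
      also have "exp \<dots> = q ^ n"
        by (simp only: q_def exp_of_nat_mult)
      finally show ?thesis by (simp add: A_def)
    qed
    have "summable (\<lambda>n. prob (A n))"
      by (rule summable_comparison_test'[where N=0 and g="\<lambda>n. 2 * q ^ n"])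
         (use q le in \<open>auto intro!: summable_mult summable_geometric\<close>)
    then have "AE \<omega> in M. eventually (\<lambda>n. \<omega> \<in> space M - A n) sequentially"
      by (intro borel_cantelli_AE1) (auto simp: emeasure_eq_measure)
    then show ?thesis
    proof eventually_elim
      case (elim \<omega>)
      show ?case
        using elim eventually_gt_at_top[of 0]
      proof eventually_elim
        case (elim n)
        have "sample_mean (\<lambda>i. Y i \<omega>) n - \<mu> = ((\<Sum>i=1..n. Y i \<omega>) - real n * \<mu>) / real n"
          using elim by (simp add: sample_mean_def field_simps)
        then have "\<bar>sample_mean (\<lambda>i. Y i \<omega>) n - \<mu>\<bar> = \<bar>(\<Sum>i=1..n. Y i \<omega>) - real n * \<mu>\<bar> / real n"
          by (simp only: abs_divide abs_of_nat)
        also have "\<dots> < \<epsilon>"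
          using elim by (subst pos_divide_less_eq) (auto simp: A_def not_le mult.commute)
        finally show ?case .
      qed
    qed
  qed
  have "AE \<omega> in M. \<forall>k. eventually (\<lambda>n. \<bar>sample_mean (\<lambda>i. Y i \<omega>) n - \<mu>\<bar> < 1 / Suc k) sequentially"
    unfolding AE_all_countable by (intro allI eventually_close) simp
  then show ?thesis
  proof eventually_elim
    case (elim \<omega>)
    show ?case
    proof (rule tendstoI)
      fix e :: real assume "e > 0"
      then obtain k where k: "1 / Suc k < e"
        by (auto elim: nat_approx_posE)
      show "eventually (\<lambda>n. dist (sample_mean (\<lambda>i. Y i \<omega>) n) \<mu> < e) sequentially"
        using elim[rule_format, of k] by eventually_elim (use k in \<open>simp add: dist_real_def\<close>)
    qed
  qed
qed

section \<open>Weighted means of monotone functions\<close>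

text \<open>
  A uniform law of large numbers over all monotone functions with values in \<open>{0..1}\<close>: \<open>G n\<close> may
  depend on the sample in any way, although the hypotheses concern only countably many fixed
  intervals.  Cut \<open>{0..M}\<close> into cells and replace \<open>G n\<close> on each cell by its value at the right
  end point.  The resulting step function contributes a finite combination, with coefficients
  in \<open>{0..1}\<close>, of the weighted means over the cells, which tend to \<open>0\<close>.  The replacement error on
  a cell is at most the increment of \<open>G n\<close> there times \<open>C\<close> times the fraction of points in the
  cell; these fractions are uniformly small because \<open>\<Phi>\<close> is uniformly continuous on compact sets,
  and the increments telescope to at most \<open>1\<close>, however many cells there are.
\<close>

lemma monotone_weighted_mean_tendsto_0:
  fixes T W :: "nat \<Rightarrow> real" and G :: "nat \<Rightarrow> real \<Rightarrow> real" and \<Phi> :: "real \<Rightarrow> real"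
  assumes T: "\<And>i. i \<ge> 1 \<Longrightarrow> T i \<in> {0..M}"
    and W: "\<And>i. i \<ge> 1 \<Longrightarrow> \<bar>W i\<bar> \<le> C"
    and G: "\<And>n. n \<ge> 1 \<Longrightarrow> mono (G n)" "\<And>n t. n \<ge> 1 \<Longrightarrow> G n t \<in> {0..1}"
    and freq: "\<And>a b. a \<in> \<rat> \<Longrightarrow> b \<in> \<rat> \<Longrightarrow> a \<le> b \<Longrightarrow>
      sample_mean (\<lambda>i. indicator {a<..b} (T i)) \<longlonglongrightarrow> \<Phi> b - \<Phi> a"
    and cont: "continuous_on UNIV \<Phi>"
    and weights: "\<And>a b. a \<in> \<rat> \<Longrightarrow> b \<in> \<rat> \<Longrightarrow> a \<le> b \<Longrightarrow>
      sample_mean (\<lambda>i. indicator {a<..b} (T i) * W i) \<longlonglongrightarrow> 0"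
  shows "(\<lambda>n. sample_mean (\<lambda>i. G n (T i) * W i) n) \<longlonglongrightarrow> 0"
proof -
  have M: "M \<ge> 0" using T[of 1] by auto
  have C: "C \<ge> 0" using W[of 1] by auto
  have main: "eventually (\<lambda>n. \<bar>sample_mean (\<lambda>i. G n (T i) * W i) n\<bar> \<le> \<epsilon> * (1 + C)) sequentially"
    if \<epsilon>: "\<epsilon> > 0" for \<epsilon>
  proof -
    have "uniformly_continuous_on {-1..M+1} \<Phi>"
      by (intro compact_uniformly_continuous continuous_on_subset[OF cont]) auto
    then obtain \<delta> where \<delta>: "\<delta> > 0"
      "\<And>s t. s \<in> {-1..M+1} \<Longrightarrow> t \<in> {-1..M+1} \<Longrightarrow> dist s t < \<delta> \<Longrightarrow> dist (\<Phi> s) (\<Phi> t) < \<epsilon>"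
      using \<epsilon> unfolding uniformly_continuous_on_def by metis
    obtain m0 where m0: "1 / real (Suc m0) < \<delta>"
      using \<delta>(1) nat_approx_posE by blast
    define m where "m = real (Suc m0)"
    have m: "m > 0" "1 / m < \<delta>" "m \<ge> 1" "m \<in> \<rat>"
      using m0 by (auto simp: m_def)
    define K where "K = nat \<lceil>M * m\<rceil>"
    (* The cells have width 1 / m and integer multiples of 1 / m as end points, so the cell of t
       is found by rounding t * m up.  The first cell ends at 0, so that it catches t = 0. *)
    define c where "c j = (real j - 1) / m" for j
    have K: "real K \<le> M * m + 1" "M * m \<le> real K"
      unfolding K_def using M m by (simp_all add: ceiling_le_iff)
    have c_rat: "c j \<in> \<rat>" for j
      using m by (simp add: c_def)
    have c_less: "c j < c (Suc j)" for j
      using m by (simp add: c_def field_simps)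
    have c_mono: "mono c"
      using c_less by (intro mono_iff_le_Suc[THEN iffD2]) (auto intro: less_imp_le)
    have c_bounds: "c j \<in> {-1..M+1}" if "j \<le> Suc K" for j
    proof -
      have "real j - 1 \<le> M * m + 1" using that K by linarith
      also have "\<dots> \<le> (M + 1) * m" using m by (simp add: algebra_simps)
      finally have "c j \<le> M + 1" using m by (simp add: c_def field_simps)
      moreover have "-1 \<le> c j" using m by (simp add: c_def field_simps)
      ultimately show ?thesis by simp
    qed
    have small: "\<Phi> (c (Suc j)) - \<Phi> (c j) < \<epsilon>" if "j \<le> K" for j
    proof -
      have "dist (c (Suc j)) (c j) = 1 / m"
        using m by (simp add: c_def dist_real_def field_simps abs_if)
      then show ?thesis
        using \<delta>(2)[of "c (Suc j)" "c j"] c_bounds[of j] c_bounds[of "Suc j"] that m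
        by (auto simp: dist_real_def)
    qed
    define I where "I j = {c j<..c (Suc j)}" for j
    have cover: "(\<Sum>j\<le>K. indicator (I j) t) = (1 :: real)" if "t \<in> {0..M}" for t
    proof -
      define j0 where "j0 = nat \<lceil>t * m\<rceil>"
      have "t * m \<le> M * m" using that m by simp
      then have j0K: "j0 \<le> K" unfolding j0_def K_def by (intro nat_mono ceiling_mono)
      have iff: "t \<in> I j \<longleftrightarrow> j = j0" for j
      proof -
        have "t \<in> I j \<longleftrightarrow> real_of_int (int j) - 1 < t * m \<and> t * m \<le> real_of_int (int j)"
          using m by (auto simp: I_def c_def field_simps)
        also have "\<dots> \<longleftrightarrow> \<lceil>t * m\<rceil> = int j"
          by (rule ceiling_eq_iff[symmetric])
        also have "\<dots> \<longleftrightarrow> j = j0"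
        proof -
          have "0 \<le> t * m" using that m by simp
          then have "0 \<le> \<lceil>t * m\<rceil>" by linarith
          then show ?thesis by (auto simp: j0_def)
        qed
        finally show ?thesis .
      qed
      have "(\<Sum>j\<le>K. indicator (I j) t) = (\<Sum>j\<le>K. if j = j0 then 1 else (0::real))"
        by (intro sum.cong) (auto simp: indicator_def iff)
      then show ?thesis using j0K by simp
    qed
    have ev1: "eventually (\<lambda>n. \<forall>j\<in>{..K}. sample_mean (\<lambda>i. indicator (I j) (T i)) n < \<epsilon>) sequentially"
    proof (rule eventually_ball_finite, simp, intro ballI)
      fix j assume "j \<in> {..K}"
      then show "eventually (\<lambda>n. sample_mean (\<lambda>i. indicator (I j) (T i)) n < \<epsilon>) sequentially"
        unfolding I_def using small[of j] c_less[of j]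
        by (intro order_tendstoD(2)[OF freq]) (auto intro: c_rat)
    qed
    have "(\<lambda>n. \<Sum>j\<le>K. \<bar>sample_mean (\<lambda>i. indicator (I j) (T i) * W i) n\<bar>) \<longlonglongrightarrow> (\<Sum>j\<le>K. \<bar>0\<bar>)"
      unfolding I_def using c_less
      by (intro tendsto_sum tendsto_rabs weights) (auto intro: c_rat less_imp_le)
    then have ev2: "eventually (\<lambda>n. (\<Sum>j\<le>K. \<bar>sample_mean (\<lambda>i. indicator (I j) (T i) * W i) n\<bar>) < \<epsilon>) sequentially"
      using \<epsilon> by (intro order_tendstoD(2)) auto
    show ?thesis
      using ev1 ev2 eventually_ge_at_top[of 1]
    proof eventually_elim
      case (elim n)
      define g where "g j = G n (c j)" for j
      have g_le: "g j \<le> g (Suc j)" for j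
        unfolding g_def using c_less[of j] G(1)[OF elim(3)] by (intro monoD[of "G n"]) auto
      have g01: "g j \<in> {0..1}" for j
        unfolding g_def using G(2)[OF elim(3)] .
      have split: "G n (T i) * W i = (\<Sum>j\<le>K. g (Suc j) * (indicator (I j) (T i) * W i))
          - (\<Sum>j\<le>K. (g (Suc j) - G n (T i)) * (indicator (I j) (T i) * W i))" if "i \<ge> 1" for i
      proof -
        have "(\<Sum>j\<le>K. g (Suc j) * (indicator (I j) (T i) * W i))
          - (\<Sum>j\<le>K. (g (Suc j) - G n (T i)) * (indicator (I j) (T i) * W i))
          = (\<Sum>j\<le>K. G n (T i) * W i * indicator (I j) (T i))"
          by (simp add: sum_subtractf[symmetric] algebra_simps)
        also have "\<dots> = G n (T i) * W i"
          using cover[OF T[OF that]] by (simp add: sum_distrib_left[symmetric])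
        finally show ?thesis by simp
      qed
      have err: "\<bar>(g (Suc j) - G n (T i)) * (indicator (I j) (T i) * W i)\<bar>
          \<le> C * (g (Suc j) - g j) * indicator (I j) (T i)" if "i \<ge> 1" for i j
      proof (cases "T i \<in> I j")
        case True
        then have "g j \<le> G n (T i)" "G n (T i) \<le> g (Suc j)"
          unfolding g_def using G(1)[OF elim(3)] by (auto intro!: monoD[of "G n"] simp: I_def)
        then have "\<bar>g (Suc j) - G n (T i)\<bar> * \<bar>W i\<bar> \<le> (g (Suc j) - g j) * C"
          using W[OF that] by (intro mult_mono) auto
        then show ?thesis using True by (simp add: abs_mult mult_ac)
      qed simp
      have "sample_mean (\<lambda>i. G n (T i) * W i) n =
          (\<Sum>j\<le>K. g (Suc j) * sample_mean (\<lambda>i. indicator (I j) (T i) * W i) n)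
          - (\<Sum>j\<le>K. sample_mean (\<lambda>i. (g (Suc j) - G n (T i)) * (indicator (I j) (T i) * W i)) n)"
        by (simp only: sample_mean_cong[OF split] sample_mean_diff sample_mean_sum sample_mean_cmult)
      also have "\<bar>\<dots>\<bar> \<le> (\<Sum>j\<le>K. \<bar>sample_mean (\<lambda>i. indicator (I j) (T i) * W i) n\<bar>)
          + (\<Sum>j\<le>K. C * (g (Suc j) - g j) * \<epsilon>)"
      proof -
        have "\<bar>\<Sum>j\<le>K. g (Suc j) * sample_mean (\<lambda>i. indicator (I j) (T i) * W i) n\<bar>
            \<le> (\<Sum>j\<le>K. \<bar>sample_mean (\<lambda>i. indicator (I j) (T i) * W i) n\<bar>)"
          by (rule order_trans[OF sum_abs], intro sum_mono)
             (use g01 in \<open>auto simp: abs_mult intro!: mult_left_le_one_le\<close>)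
        moreover have "\<bar>\<Sum>j\<le>K. sample_mean (\<lambda>i. (g (Suc j) - G n (T i)) * (indicator (I j) (T i) * W i)) n\<bar>
            \<le> (\<Sum>j\<le>K. C * (g (Suc j) - g j) * \<epsilon>)"
        proof (rule order_trans[OF sum_abs], intro sum_mono)
          fix j assume j: "j \<in> {..K}"
          have "\<bar>sample_mean (\<lambda>i. (g (Suc j) - G n (T i)) * (indicator (I j) (T i) * W i)) n\<bar>
              \<le> sample_mean (\<lambda>i. C * (g (Suc j) - g j) * indicator (I j) (T i)) n"
            by (rule order_trans[OF abs_sample_mean_le], intro sample_mean_mono err)
          also have "\<dots> = C * (g (Suc j) - g j) * sample_mean (\<lambda>i. indicator (I j) (T i)) n"
            by (rule sample_mean_cmult)
          also have "\<dots> \<le> C * (g (Suc j) - g j) * \<epsilon>"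
            using elim(1) j C g_le[of j] by (intro mult_left_mono) (auto intro: less_imp_le)
          finally show "\<bar>sample_mean (\<lambda>i. (g (Suc j) - G n (T i)) * (indicator (I j) (T i) * W i)) n\<bar>
              \<le> C * (g (Suc j) - g j) * \<epsilon>" .
        qed
        ultimately show ?thesis by linarith
      qed
      also have "(\<Sum>j\<le>K. C * (g (Suc j) - g j) * \<epsilon>) = C * \<epsilon> * (g (Suc K) - g 0)"
        using sum_lessThan_telescope[of g "Suc K"]
        by (simp add: sum_distrib_left[symmetric] sum_distrib_right[symmetric] lessThan_Suc_atMost mult_ac)
      also have "\<dots> \<le> C * \<epsilon> * 1"
        using C \<epsilon> g01[of "Suc K"] g01[of 0] by (intro mult_left_mono) auto
      finally show ?case using elim(2) by (simp add: algebra_simps)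
    qed
  qed
  show ?thesis
  proof (rule tendstoI)
    fix e :: real assume "e > 0"
    define \<epsilon> where "\<epsilon> = e / (2 * (1 + C))"
    have \<epsilon>: "\<epsilon> > 0" "\<epsilon> * (1 + C) < e"
      using C \<open>e > 0\<close> by (auto simp: \<epsilon>_def field_simps add_pos_nonneg)
    show "eventually (\<lambda>n. dist (sample_mean (\<lambda>i. G n (T i) * W i) n) 0 < e) sequentially"
      using main[OF \<epsilon>(1)] by eventually_elim (use \<epsilon>(2) in simp)
  qed
qed

section \<open>Convergence of distribution functions\<close>

lemma distribution_function_range:
  assumes "distribution_function F"
  shows "0 \<le> F t" "F t \<le> 1"
proof -
  have F: "mono F" "(F \<longlongrightarrow> 0) at_bot" "(F \<longlongrightarrow> 1) at_top"
    using assms by (auto simp: distribution_function_def)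
  show "0 \<le> F t"
    by (rule tendsto_upperbound[OF F(2)])
       (use F(1) in \<open>auto simp: eventually_at_bot_linorder mono_def\<close>)
  show "F t \<le> 1"
    by (rule tendsto_lowerbound[OF F(3)])
       (use F(1) in \<open>auto simp: eventually_at_top_linorder mono_def\<close>)
qed

text \<open>
  Polya's theorem.  By continuity the limit \<open>F0\<close> attains the levels \<open>k / K\<close>, and eventually \<open>F n\<close>
  is close to \<open>F0\<close> at these finitely many quantiles.  Any \<open>t\<close> lies between quantiles whose levels
  differ from \<open>F0 t\<close> by at most \<open>1 / K\<close>, so monotonicity of \<open>F n\<close> transfers the closeness
  to \<open>t\<close>; beyond the extreme quantiles the bounds \<open>0 \<le> F n t \<le> 1\<close> take over.
\<close>

lemma uniform_limit_distribution_function: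
  fixes F :: "nat \<Rightarrow> real \<Rightarrow> real"
  assumes F0: "distribution_function F0" "continuous_on UNIV F0"
    and F: "\<And>n. n \<ge> 1 \<Longrightarrow> mono (F n)" "\<And>n t. n \<ge> 1 \<Longrightarrow> F n t \<in> {0..1}"
    and lim: "\<And>t. (\<lambda>n. F n t) \<longlonglongrightarrow> F0 t"
  shows "uniform_limit UNIV F F0 sequentially"
proof (rule uniform_limitI)
  fix e :: real assume "e > 0"
  then obtain K0 where K0: "1 / real (Suc K0) < e / 2"
    using nat_approx_posE[of "e/2"] by auto
  define K where "K = Suc K0"
  have K: "K > 0" "1 / real K < e / 2" using K0 by (auto simp: K_def)
  have "\<exists>t. F0 t = real k / real K" if "k \<in> {1..<K}" for k
  proof -
    have "eventually (\<lambda>t. F0 t < real k / real K) at_bot"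
      using F0 that by (intro order_tendstoD(2)[of F0 0]) (auto simp: distribution_function_def)
    then obtain a where a: "F0 a < real k / real K"
      using eventually_happens trivial_limit_at_bot_linorder by blast
    have "eventually (\<lambda>t. real k / real K < F0 t) at_top"
      using F0 that by (intro order_tendstoD(1)[of F0 1]) (auto simp: distribution_function_def)
    then obtain b where b: "real k / real K < F0 b"
      using eventually_happens trivial_limit_at_top_linorder by blast
    have "mono F0" using F0(1) by (simp add: distribution_function_def)
    with a b have "a \<le> b" by (meson linorder_le_cases monoD not_less order.strict_trans order_less_imp_le)
    with IVT'[of F0 a "real k / real K" b] a b continuous_on_subset[OF F0(2)]
    show ?thesis by auto
  qed
  then obtain q where q: "\<And>k. k \<in> {1..<K} \<Longrightarrow> F0 (q k) = real k / real K"
    by metis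
  have "eventually (\<lambda>n. \<forall>k\<in>{1..<K}. dist (F n (q k)) (F0 (q k)) < e / 2) sequentially"
    using \<open>e > 0\<close> by (intro eventually_ball_finite ballI tendstoD[OF lim]) auto
  then show "\<forall>\<^sub>F n in sequentially. \<forall>t\<in>UNIV. dist (F n t) (F0 t) < e"
    using eventually_ge_at_top[of 1]
  proof eventually_elim
    case (elim n)
    have monoF0: "mono F0" using F0(1) by (simp add: distribution_function_def)
    have close: "\<bar>F n (q k) - real k / real K\<bar> < e / 2" if "k \<in> {1..<K}" for k
      using elim(1) that by (simp add: dist_real_def q)
    have less: "s < t" if "F0 s < F0 t" for s t
      using that monoF0 by (meson monoD not_less)
    show ?case
    proof
      fix t
      note r = distribution_function_range[OF F0(1), of t]
      have upper: "F n t < F0 t + e"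
      proof -
        define k where "k = nat (\<lfloor>F0 t * K\<rfloor> + 1)"
        have k0: "real k = of_int \<lfloor>F0 t * K\<rfloor> + 1"
          using r(1) by (simp add: k_def)
        have k: "F0 t * K < real k" "real k \<le> F0 t * K + 1"
          unfolding k0 by linarith+
        have k': "F0 t < real k / K" "real k / K \<le> F0 t + 1 / K"
          using k K by (auto simp: field_simps)
        show ?thesis
        proof (cases "k < K")
          case True
          have "F0 t * K \<ge> 0" using r by simp
          then have kin: "k \<in> {1..<K}" using True k(1) by (cases k) auto
          have "F n t \<le> F n (q k)"
            using less[of t "q k"] k' q[OF kin] by (intro monoD[OF F(1)[OF elim(2)]]) auto
          then show ?thesis using close[OF kin] k' K by linarith
        next
          case False
          have "1 \<le> real k / K" using False K by (simp add: field_simps)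
          moreover have "F n t \<le> 1" using F(2)[OF elim(2)] by auto
          ultimately show ?thesis using k' K \<open>e > 0\<close> by linarith
        qed
      qed
      have lower: "F0 t - e < F n t"
      proof (cases "F0 t * K \<le> 1")
        case True
        then have "F0 t \<le> 1 / K" using K by (simp add: field_simps)
        moreover have "F n t \<ge> 0" using F(2)[OF elim(2)] by auto
        ultimately show ?thesis using K \<open>e > 0\<close> by linarith
      next
        case False
        define k where "k = nat (\<lceil>F0 t * K\<rceil> - 1)"
        have c2: "\<lceil>F0 t * K\<rceil> \<ge> 2" using False by linarith
        then have k0: "real k = of_int \<lceil>F0 t * K\<rceil> - 1"
          by (simp add: k_def)
        have k: "real k < F0 t * K" "F0 t * K \<le> real k + 1"
          unfolding k0 by linarith+
        have k': "real k / K < F0 t" "F0 t \<le> real k / K + 1 / K"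
          using k K by (auto simp: field_simps)
        have "F0 t * real K \<le> 1 * real K" using r by (intro mult_right_mono) auto
        moreover have "1 \<le> real k" using k0 c2 by linarith
        ultimately have kin: "k \<in> {1..<K}" using k(1) by auto
        have "F n (q k) \<le> F n t"
          using less[of "q k" t] k' q[OF kin] by (intro monoD[OF F(1)[OF elim(2)]]) auto
        then show ?thesis using close[OF kin] k' K by linarith
      qed
      show "dist (F n t) (F0 t) < e"
        using upper lower by (simp add: dist_real_def)
    qed
  qed
qed

lemma SUP_abs_diff_tendsto_0:
  fixes F :: "nat \<Rightarrow> 'b \<Rightarrow> real"
  assumes "uniform_limit UNIV F G sequentially"
  shows "(\<lambda>n. SUP t. \<bar>F n t - G t\<bar>) \<longlonglongrightarrow> 0"
proof (rule tendstoI)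
  fix e :: real assume "e > 0"
  then have "\<forall>\<^sub>F n in sequentially. \<forall>t\<in>UNIV. dist (F n t) (G t) < e / 2"
    using assms by (intro uniform_limitD) auto
  then show "\<forall>\<^sub>F n in sequentially. dist (SUP t. \<bar>F n t - G t\<bar>) 0 < e"
  proof eventually_elim
    case (elim n)
    have le: "\<bar>F n t - G t\<bar> \<le> e / 2" for t
      using elim by (auto simp: dist_real_def intro: less_imp_le)
    then have "(SUP t. \<bar>F n t - G t\<bar>) \<le> e / 2"
      by (intro cSUP_least) auto
    moreover have "\<bar>F n undefined - G undefined\<bar> \<le> (SUP t. \<bar>F n t - G t\<bar>)"
      by (rule cSUP_upper) (use le in \<open>auto intro!: bdd_aboveI[of _ "e/2"]\<close>)
    then have "0 \<le> (SUP t. \<bar>F n t - G t\<bar>)" by linarith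
    ultimately show ?case using \<open>e > 0\<close> by simp
  qed
qed

text \<open>
  If \<open>F n a\<close> exceeded \<open>F0 b\<close> by \<open>\<epsilon>\<close>, then monotonicity would force \<open>F n\<close> to exceed \<open>F0\<close> by \<open>\<epsilon>\<close>
  on the whole interval \<open>{a<..b}\<close>, and since a positive fraction of the points lies there,
  the mean square distance could not vanish.  The other inequality is symmetric.
\<close>

lemma mean_square_deviation_controls_values:
  fixes F :: "nat \<Rightarrow> real \<Rightarrow> real"
  assumes F: "\<And>n. n \<ge> 1 \<Longrightarrow> mono (F n)" and F0: "mono F0"
    and sq: "(\<lambda>n. sample_mean (\<lambda>i. (F n (T i) - F0 (T i))\<^sup>2) n) \<longlonglongrightarrow> 0"
    and freq: "sample_mean (\<lambda>i. indicator {a<..b} (T i)) \<longlonglongrightarrow> p" "p > 0"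
    and \<epsilon>: "\<epsilon> > 0"
  shows "\<forall>\<^sub>F n in sequentially. F n a < F0 b + \<epsilon> \<and> F0 a - \<epsilon> < F n b"
proof -
  have "\<forall>\<^sub>F n in sequentially. p / 2 < sample_mean (\<lambda>i. indicator {a<..b} (T i)) n"
    using freq by (intro order_tendstoD(1)[OF freq(1)]) auto
  moreover have "\<forall>\<^sub>F n in sequentially. sample_mean (\<lambda>i. (F n (T i) - F0 (T i))\<^sup>2) n < \<epsilon>\<^sup>2 * (p / 2)"
    using freq \<epsilon> by (intro order_tendstoD(2)[OF sq]) auto
  ultimately show ?thesis
    using eventually_ge_at_top[of 1]
  proof eventually_elim
    case (elim n)
    show ?case
    proof (rule ccontr)
      assume neg: "\<not> ?case"
      have "\<epsilon>\<^sup>2 * indicator {a<..b} (T i) \<le> (F n (T i) - F0 (T i))\<^sup>2" for i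
      proof (cases "T i \<in> {a<..b}")
        case True
        then have "F n a \<le> F n (T i)" "F n (T i) \<le> F n b" "F0 a \<le> F0 (T i)" "F0 (T i) \<le> F0 b"
          using F[OF elim(3)] F0 by (auto intro: monoD)
        with neg have "\<epsilon> \<le> \<bar>F n (T i) - F0 (T i)\<bar>" by linarith
        then show ?thesis using True \<epsilon> power_mono[of \<epsilon> "\<bar>F n (T i) - F0 (T i)\<bar>" 2] by simp
      qed simp
      then have "sample_mean (\<lambda>i. \<epsilon>\<^sup>2 * indicator {a<..b} (T i)) n
          \<le> sample_mean (\<lambda>i. (F n (T i) - F0 (T i))\<^sup>2) n"
        by (rule sample_mean_mono)
      moreover have "\<epsilon>\<^sup>2 * (p / 2) < \<epsilon>\<^sup>2 * sample_mean (\<lambda>i. indicator {a<..b} (T i)) n"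
        using elim(1) \<epsilon> by (intro mult_strict_left_mono) auto
      ultimately show False unfolding sample_mean_cmult using elim(2) by linarith
    qed
  qed
qed

text \<open>
  Mean square convergence at the sample points becomes convergence at every point: by
  continuity of \<open>F0\<close> there is an interval inside \<open>{0..M}\<close>, just to the right of \<open>max t 0\<close> if
  \<open>t < M\<close> and just to the left of \<open>min t M\<close> if \<open>0 < t\<close>, on which \<open>F0\<close> is close to \<open>F0 t\<close>, and it
  carries a positive limiting fraction of the points because \<open>\<Phi>\<close> increases strictly.  The first
  gives the upper bound on \<open>F n t\<close>, which is trivial for \<open>t \<ge> M\<close>; the second gives the lower
  bound, which is trivial for \<open>t \<le> 0\<close>.
\<close>

lemma LIMSEQ_of_mean_square_deviation:
  fixes F :: "nat \<Rightarrow> real \<Rightarrow> real"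
  assumes F: "\<And>n. n \<ge> 1 \<Longrightarrow> mono (F n)" "\<And>n t. n \<ge> 1 \<Longrightarrow> F n t \<in> {0..1}"
    and F0: "mono F0" "continuous_on UNIV F0" "\<And>t. t \<le> 0 \<Longrightarrow> F0 t = 0" "\<And>t. t \<ge> M \<Longrightarrow> F0 t = 1"
    and sq: "(\<lambda>n. sample_mean (\<lambda>i. (F n (T i) - F0 (T i))\<^sup>2) n) \<longlonglongrightarrow> 0"
    and freq: "\<And>a b. a \<in> \<rat> \<Longrightarrow> b \<in> \<rat> \<Longrightarrow> a \<le> b \<Longrightarrow>
      sample_mean (\<lambda>i. indicator {a<..b} (T i)) \<longlonglongrightarrow> \<Phi> b - \<Phi> a"
    and \<Phi>: "strict_mono_on {0..M} \<Phi>"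
  shows "(\<lambda>n. F n t) \<longlonglongrightarrow> F0 t"
proof (rule order_tendstoI)
  have at: "F0 \<midarrow>s\<rightarrow> F0 s" for s
    using F0(2) by (simp add: continuous_on_eq_continuous_at isCont_def)
  have dev: "\<forall>\<^sub>F n in sequentially. F n a < F0 b + \<epsilon> \<and> F0 a - \<epsilon> < F n b"
    if "a \<in> \<rat>" "b \<in> \<rat>" "0 \<le> a" "a < b" "b \<le> M" "\<epsilon> > 0" for a b \<epsilon>
    using that strict_mono_onD[OF \<Phi>, of a b]
    by (intro mean_square_deviation_controls_values[OF F(1) F0(1) sq freq[of a b]]) auto
  show "\<forall>\<^sub>F n in sequentially. F n t < y" if y: "F0 t < y" for y
  proof (cases "t < M")
    case False
    then show ?thesis
      using F0(4)[of t] y F(2) by (intro eventually_sequentiallyI[of 1]) (auto intro: le_less_trans)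
  next
    case True
    define s where "s = max t 0"
    have "s < M" using True F0(3)[of 0] F0(4)[of 0] by (cases "M \<le> 0") (auto simp: s_def)
    have s: "F0 s = F0 t" "t \<le> s" "0 \<le> s" using F0(3) by (auto simp: s_def max_def)
    have "\<forall>\<^sub>F z in at_right s. F0 z < y"
      using y s by (intro order_tendstoD(2)[OF tendsto_within_subset[OF at]]) auto
    then obtain b0 where b0: "b0 > s" "\<And>z. s < z \<Longrightarrow> z < b0 \<Longrightarrow> F0 z < y"
      unfolding eventually_at_right[OF \<open>s < M\<close>] by auto
    obtain b where b: "b \<in> \<rat>" "s < b" "b < min b0 M"
      using Rats_dense_in_real[of s "min b0 M"] b0 \<open>s < M\<close> by auto
    obtain a where a: "a \<in> \<rat>" "s < a" "a < b"
      using Rats_dense_in_real[of s b] b by auto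
    have "F0 b < y" using b0 b by auto
    then have "\<forall>\<^sub>F n in sequentially. F n a < F0 b + (y - F0 b) \<and> F0 a - (y - F0 b) < F n b"
      using a b s by (intro dev) auto
    then show ?thesis
      using eventually_ge_at_top[of 1]
    proof eventually_elim
      case (elim n)
      have "F n t \<le> F n a" using F(1)[OF elim(2)] a s by (intro monoD[of "F n"]) auto
      then show ?case using elim by linarith
    qed
  qed
  show "\<forall>\<^sub>F n in sequentially. y < F n t" if y: "y < F0 t" for y
  proof (cases "0 < t")
    case False
    then show ?thesis
      using F0(3)[of t] y F(2) by (intro eventually_sequentiallyI[of 1]) (auto intro: less_le_trans)
  next
    case True
    define s where "s = min t M"
    have "0 < s" using True F0(3)[of M] F0(4)[of M] by (cases "M \<le> 0") (auto simp: s_def)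
    have s: "F0 s = F0 t" "s \<le> t" "s \<le> M" using F0(4) by (auto simp: s_def min_def)
    have "\<forall>\<^sub>F z in at_left s. y < F0 z"
      using y s by (intro order_tendstoD(1)[OF tendsto_within_subset[OF at]]) auto
    then obtain a0 where a0: "a0 < s" "\<And>z. a0 < z \<Longrightarrow> z < s \<Longrightarrow> y < F0 z"
      unfolding eventually_at_left[OF \<open>0 < s\<close>] by auto
    obtain a where a: "a \<in> \<rat>" "max a0 0 < a" "a < s"
      using Rats_dense_in_real[of "max a0 0" s] a0 \<open>0 < s\<close> by auto
    obtain b where b: "b \<in> \<rat>" "a < b" "b < s"
      using Rats_dense_in_real[of a s] a by auto
    have "y < F0 a" using a0 a by auto
    then have "\<forall>\<^sub>F n in sequentially. F n a < F0 b + (F0 a - y) \<and> F0 a - (F0 a - y) < F n b"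
      using a b s by (intro dev) auto
    then show ?thesis
      using eventually_ge_at_top[of 1]
    proof eventually_elim
      case (elim n)
      have "F n b \<le> F n t" using F(1)[OF elim(2)] b s by (intro monoD[of "F n"]) auto
      then show ?case using elim by linarith
    qed
  qed
qed

section \<open>The least squares estimator on a fixed sample sequence\<close>

text \<open>
  The centred indicator of \<open>x \<le> t\<close>: its mean vanishes if \<open>x\<close> has distribution function \<open>F\<close>.
\<close>

definition residual :: "(real \<Rightarrow> real) \<Rightarrow> real \<Rightarrow> real \<Rightarrow> real" where
  "residual F x t = of_bool (x \<le> t) - F t"

text \<open>
  Compare the minimiser \<open>F\<close> with the competitor \<open>F0\<close> and complete the square.  With \<open>D = F - F0\<close>
  and \<open>r\<close> the residual of \<open>F0\<close>, the three indicators are the cell probabilities under \<open>F0\<close> plus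
  the errors \<open>r u\<close>, \<open>r v - r u\<close> and \<open>- r v\<close>, so the cross term of one observation is
  \<open>D u * r u + (D v - D u) * (r v - r u) + D v * r v\<close>, regrouped here by \<open>D u\<close> and \<open>D v\<close>.  Of the
  quadratic terms only the square of \<open>D u\<close> is kept.
\<close>

lemma basic_inequality:
  assumes lse: "isotonic_lse n x u v F" and F0: "distribution_function F0"
    and ord: "\<And>i. i \<ge> 1 \<Longrightarrow> u i < v i"
  shows "sample_mean (\<lambda>i. (F (u i) - F0 (u i))\<^sup>2) n \<le>
     2 * sample_mean (\<lambda>i. (F (u i) - F0 (u i)) * (2 * residual F0 (x i) (u i) - residual F0 (x i) (v i))
                   + (F (v i) - F0 (v i)) * (2 * residual F0 (x i) (v i) - residual F0 (x i) (u i))) n"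
proof -
  define t where "t G i = (G (u i) - Delta0 (x i) (u i) (v i))\<^sup>2
             + (G (v i) - G (u i) - Delta1 (x i) (u i) (v i))\<^sup>2
             + (1 - G (v i) - Delta2 (x i) (u i) (v i))\<^sup>2" for G i
  define w where "w i = (F (u i) - F0 (u i)) * (2 * residual F0 (x i) (u i) - residual F0 (x i) (v i))
                   + (F (v i) - F0 (v i)) * (2 * residual F0 (x i) (v i) - residual F0 (x i) (u i))" for i
  have "ls_criterion n x u v F \<le> ls_criterion n x u v F0"
    using lse F0 by (simp add: isotonic_lse_def)
  then have "sample_mean (t F) n \<le> sample_mean (t F0) n"
    by (simp add: ls_criterion_def t_def sample_mean_def divide_right_mono)
  moreover have "(F (u i) - F0 (u i))\<^sup>2 - 2 * w i \<le> t F i - t F0 i" if i: "i \<ge> 1" for i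
  proof -
    define D where "D s = F s - F0 s" for s
    define r where "r s = residual F0 (x i) s" for s
    have FD: "F s = F0 s + D s" for s by (simp add: D_def)
    have d0: "Delta0 (x i) (u i) (v i) = F0 (u i) + r (u i)"
      by (simp add: Delta0_def r_def residual_def)
    have d1: "Delta1 (x i) (u i) (v i) = F0 (v i) - F0 (u i) + r (v i) - r (u i)"
      using ord[OF i] by (auto simp: Delta1_def r_def residual_def)
    have d2: "Delta2 (x i) (u i) (v i) = 1 - F0 (v i) - r (v i)"
      unfolding Delta2_def d0 d1 by simp
    have "t F i - t F0 i = (D (u i))\<^sup>2 + (D (v i) - D (u i))\<^sup>2 + (D (v i))\<^sup>2 - 2 * w i"
      unfolding t_def w_def d0 d1 d2 r_def[symmetric] D_def[symmetric] FD
      by (simp add: power2_eq_square algebra_simps)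
    then show ?thesis by (simp add: D_def)
  qed
  then have "sample_mean (\<lambda>i. (F (u i) - F0 (u i))\<^sup>2 - 2 * w i) n \<le> sample_mean (\<lambda>i. t F i - t F0 i) n"
    by (rule sample_mean_mono)
  ultimately show ?thesis
    unfolding w_def[symmetric] sample_mean_diff sample_mean_cmult by linarith
qed

text \<open>
  The deterministic core: all that consistency needs from randomness is the convergence of
  countably many sample means.  The right-hand side of \<open>basic_inequality\<close> is a sum of weighted means
  of the monotone functions \<open>F n\<close> and \<open>F0\<close>, with weights that average out over every interval;
  it vanishes, and hence so does the mean square distance of \<open>F n\<close> and \<open>F0\<close> at the points \<open>u i\<close>.
\<close>

theorem lse_uniformly_consistent_on_regular_samples:
  fixes x u v :: "nat \<Rightarrow> real" and F :: "nat \<Rightarrow> real \<Rightarrow> real"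
  assumes F0: "distribution_function F0" "continuous_on UNIV F0"
      "\<And>t. t \<le> 0 \<Longrightarrow> F0 t = 0" "\<And>t. t \<ge> M \<Longrightarrow> F0 t = 1"
    and lse: "\<And>n. n \<ge> 1 \<Longrightarrow> isotonic_lse n x u v (F n)"
    and obs: "\<And>i. i \<ge> 1 \<Longrightarrow> (u i, v i) \<in> obs_domain M"
    and freq_u: "\<And>a b. a \<in> \<rat> \<Longrightarrow> b \<in> \<rat> \<Longrightarrow> a \<le> b \<Longrightarrow>
      sample_mean (\<lambda>i. indicator {a<..b} (u i)) \<longlonglongrightarrow> \<Phi> b - \<Phi> a"
    and freq_v: "\<And>a b. a \<in> \<rat> \<Longrightarrow> b \<in> \<rat> \<Longrightarrow> a \<le> b \<Longrightarrow>
      sample_mean (\<lambda>i. indicator {a<..b} (v i)) \<longlonglongrightarrow> \<Psi> b - \<Psi> a"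
    and \<Phi>: "continuous_on UNIV \<Phi>" "strict_mono_on {0..M} \<Phi>"
    and \<Psi>: "continuous_on UNIV \<Psi>"
    and orth: "\<And>a b s t. a \<in> \<rat> \<Longrightarrow> b \<in> \<rat> \<Longrightarrow> a \<le> b \<Longrightarrow> s \<in> {u, v} \<Longrightarrow> t \<in> {u, v} \<Longrightarrow>
      sample_mean (\<lambda>i. indicator {a<..b} (s i) * residual F0 (x i) (t i)) \<longlonglongrightarrow> 0"
  shows "uniform_limit UNIV F F0 sequentially"
proof -
  have df: "distribution_function (F n)" if "n \<ge> 1" for n
    using lse[OF that] by (simp add: isotonic_lse_def)
  have mono: "mono G" if "distribution_function G" for G
    using that by (simp add: distribution_function_def)
  have range: "G t \<in> {0..1}" if "distribution_function G" for G t
    using distribution_function_range[OF that] by auto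
  have T: "u i \<in> {0..M}" "v i \<in> {0..M}" "u i < v i" if "i \<ge> 1" for i
    using obs[OF that] by (auto simp: obs_domain_def)
  define Wu where "Wu i = 2 * residual F0 (x i) (u i) - residual F0 (x i) (v i)" for i
  define Wv where "Wv i = 2 * residual F0 (x i) (v i) - residual F0 (x i) (u i)" for i
  have res: "\<bar>residual F0 y t\<bar> \<le> 1" for y t
    using range[OF F0(1), of t] by (auto simp: residual_def)
  have W: "\<bar>Wu i\<bar> \<le> 3" "\<bar>Wv i\<bar> \<le> 3" for i
    using res[of "x i" "u i"] res[of "x i" "v i"] by (auto simp: Wu_def Wv_def abs_le_iff)
  have weights: "sample_mean (\<lambda>i. indicator {a<..b} (s i) * Wu i) \<longlonglongrightarrow> 0"
      "sample_mean (\<lambda>i. indicator {a<..b} (s i) * Wv i) \<longlonglongrightarrow> 0"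
    if ab: "a \<in> \<rat>" "b \<in> \<rat>" "a \<le> b" and s: "s \<in> {u, v}" for a b s
    using tendsto_diff[OF tendsto_mult_left[OF orth[OF ab s, of u], of 2] orth[OF ab s, of v]]
      tendsto_diff[OF tendsto_mult_left[OF orth[OF ab s, of v], of 2] orth[OF ab s, of u]]
    unfolding Wu_def Wv_def sample_mean_cmult[symmetric] sample_mean_diff[symmetric]
    by (simp_all add: algebra_simps)
  have lim_u: "(\<lambda>n. sample_mean (\<lambda>i. G n (u i) * Wu i) n) \<longlonglongrightarrow> 0"
    if "\<And>n. n \<ge> 1 \<Longrightarrow> distribution_function (G n)" for G
    by (rule monotone_weighted_mean_tendsto_0[where M=M and C=3 and \<Phi>=\<Phi>])
       (use T W mono range that freq_u \<Phi> weights in auto)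
  have lim_v: "(\<lambda>n. sample_mean (\<lambda>i. G n (v i) * Wv i) n) \<longlonglongrightarrow> 0"
    if "\<And>n. n \<ge> 1 \<Longrightarrow> distribution_function (G n)" for G
    by (rule monotone_weighted_mean_tendsto_0[where M=M and C=3 and \<Phi>=\<Psi>])
       (use T W mono range that freq_v \<Psi> weights in auto)
  define R where "R n = sample_mean (\<lambda>i. F n (u i) * Wu i) n - sample_mean (\<lambda>i. F0 (u i) * Wu i) n
     + (sample_mean (\<lambda>i. F n (v i) * Wv i) n - sample_mean (\<lambda>i. F0 (v i) * Wv i) n)" for n
  have "(\<lambda>n. 2 * R n) \<longlonglongrightarrow> 2 * (0 - 0 + (0 - 0))"
    unfolding R_def
    by (intro tendsto_intros lim_u lim_v lim_u[of "\<lambda>_. F0"] lim_v[of "\<lambda>_. F0"] df F0(1))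
  then have R: "(\<lambda>n. 2 * R n) \<longlonglongrightarrow> 0" by simp
  have sq: "(\<lambda>n. sample_mean (\<lambda>i. (F n (u i) - F0 (u i))\<^sup>2) n) \<longlonglongrightarrow> 0"
  proof (rule tendsto_sandwich[OF _ _ tendsto_const R])
    show "\<forall>\<^sub>F n in sequentially. 0 \<le> sample_mean (\<lambda>i. (F n (u i) - F0 (u i))\<^sup>2) n"
      by (simp add: sample_mean_def sum_nonneg)
    show "\<forall>\<^sub>F n in sequentially. sample_mean (\<lambda>i. (F n (u i) - F0 (u i))\<^sup>2) n \<le> 2 * R n"
    proof (rule eventually_sequentiallyI[of 1])
      fix n :: nat assume n: "1 \<le> n"
      have "sample_mean (\<lambda>i. (F n (u i) - F0 (u i))\<^sup>2) n \<le>
         2 * sample_mean (\<lambda>i. (F n (u i) - F0 (u i)) * Wu i + (F n (v i) - F0 (v i)) * Wv i) n"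
        unfolding Wu_def Wv_def by (rule basic_inequality[OF lse[OF n] F0(1)]) (use T in auto)
      also have "\<dots> = 2 * R n"
        by (simp only: R_def left_diff_distrib sample_mean_add sample_mean_diff)
      finally show "sample_mean (\<lambda>i. (F n (u i) - F0 (u i))\<^sup>2) n \<le> 2 * R n" .
    qed
  qed
  show ?thesis
    by (rule uniform_limit_distribution_function[OF F0(1,2)])
       (use df mono range F0 in \<open>auto intro!: LIMSEQ_of_mean_square_deviation[OF _ _ _ F0(2-4) sq freq_u \<Phi>(2)]\<close>)
qed

section \<open>Residuals and inspection times under the sampling model\<close>

lemma (in prob_space) distr_Pair_of_indep_rv:
  assumes "indep_rv M S X T Z"
  shows "distr M S X \<Otimes>\<^sub>M distr M T Z = distr M (S \<Otimes>\<^sub>M T) (\<lambda>\<omega>. (X \<omega>, Z \<omega>))"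
proof -
  have [measurable]: "X \<in> measurable M S" "Z \<in> measurable M T"
    and indep: "indep_set {X -` A \<inter> space M |A. A \<in> sets S} {Z -` B \<inter> space M |B. B \<in> sets T}"
    using assms by (auto simp: indep_rv_def)
  show ?thesis
  proof (rule pair_measure_eqI)
    fix A B assume "A \<in> sets (distr M S X)" "B \<in> sets (distr M T Z)"
    then have [measurable]: "A \<in> sets S" "B \<in> sets T" by auto
    have "prob ((X -` A \<inter> space M) \<inter> (Z -` B \<inter> space M)) = prob (X -` A \<inter> space M) * prob (Z -` B \<inter> space M)"
      by (intro indep_setD[OF indep]) auto
    moreover have "(\<lambda>\<omega>. (X \<omega>, Z \<omega>)) -` (A \<times> B) \<inter> space M = (X -` A \<inter> space M) \<inter> (Z -` B \<inter> space M)"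
      by auto
    ultimately show "emeasure (distr M S X) A * emeasure (distr M T Z) B
        = emeasure (distr M (S \<Otimes>\<^sub>M T) (\<lambda>\<omega>. (X \<omega>, Z \<omega>))) (A \<times> B)"
      by (simp add: emeasure_distr emeasure_eq_measure ennreal_mult[symmetric])
  qed (auto intro!: prob_space_imp_sigma_finite prob_space_distr cong: sets_pair_measure_cong)
qed

text \<open>
  By independence and Fubini one may integrate over \<open>X\<close> first, with \<open>z = Z \<omega>\<close> held fixed; the
  inner integral is \<open>w z\<close> times the mean of a centred indicator.
\<close>

lemma (in prob_space) expectation_weighted_residual_eq_0:
  assumes indep: "indep_rv M borel X T Z"
    and F: "cdf (distr M borel X) = F"
    and g [measurable]: "g \<in> borel_measurable T"
    and w [measurable]: "w \<in> borel_measurable T" "\<And>z. \<bar>w z\<bar> \<le> B"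
  shows "expectation (\<lambda>\<omega>. w (Z \<omega>) * residual F (X \<omega>) (g (Z \<omega>))) = 0"
proof -
  have [measurable]: "X \<in> borel_measurable M" "Z \<in> measurable M T"
    using indep by (auto simp: indep_rv_def)
  define \<mu> where "\<mu> = distr M borel X"
  define \<nu> where "\<nu> = distr M T Z"
  interpret X: real_distribution \<mu>
    unfolding \<mu>_def by (rule real_distribution_distr) simp
  interpret Z: prob_space \<nu> unfolding \<nu>_def by (rule prob_space_distr) simp
  interpret XZ: pair_prob_space \<mu> \<nu> ..
  have F': "F = cdf \<mu>" using F by (simp add: \<mu>_def)
  have [measurable]: "F \<in> borel_measurable borel"
    unfolding F' using X.cdf_nondecreasing by (intro borel_measurable_mono) (auto simp: mono_def)
  have [measurable_cong]: "sets \<nu> = sets T" by (simp add: \<nu>_def)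
  have F01: "0 \<le> F t" "F t \<le> 1" for t
    using X.cdf_nonneg X.cdf_bounded_prob by (auto simp: F')
  define \<phi> where "\<phi> x z = w z * residual F x (g z)" for x z
  have meas [measurable]: "(\<lambda>(x, z). \<phi> x z) \<in> borel_measurable (borel \<Otimes>\<^sub>M T)"
    unfolding \<phi>_def residual_def by measurable
  have bd: "\<bar>\<phi> x z\<bar> \<le> B" for x z
  proof -
    have "\<bar>residual F x (g z)\<bar> \<le> 1" using F01[of "g z"] by (auto simp: residual_def)
    then have "\<bar>w z\<bar> * \<bar>residual F x (g z)\<bar> \<le> B * 1"
      using w(2)[of z] by (intro mult_mono) auto
    then show ?thesis by (simp add: \<phi>_def abs_mult)
  qed
  have int: "integrable (\<mu> \<Otimes>\<^sub>M \<nu>) (\<lambda>(x, z). \<phi> x z)"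
    by (rule XZ.integrable_const_bound[of _ B]) (use bd in auto)
  have "expectation (\<lambda>\<omega>. \<phi> (X \<omega>) (Z \<omega>)) = (\<integral>p. (case p of (x, z) \<Rightarrow> \<phi> x z) \<partial>(\<mu> \<Otimes>\<^sub>M \<nu>))"
    unfolding \<mu>_def \<nu>_def distr_Pair_of_indep_rv[OF indep]
    by (subst integral_distr) auto
  also have "\<dots> = (\<integral>z. (\<integral>x. \<phi> x z \<partial>\<mu>) \<partial>\<nu>)"
    by (rule XZ.integral_snd[symmetric, OF int])
  also have "(\<lambda>z. \<integral>x. \<phi> x z \<partial>\<mu>) = (\<lambda>z. 0)"
  proof
    fix z
    have "(\<integral>x. residual F x (g z) \<partial>\<mu>) = (\<integral>x. indicator {..g z} x - F (g z) \<partial>\<mu>)"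
      by (intro Bochner_Integration.integral_cong) (auto simp: residual_def indicator_def)
    also have "\<dots> = measure \<mu> {..g z} - F (g z)"
      by (subst Bochner_Integration.integral_diff) (auto simp: X.emeasure_eq_measure X.prob_space[unfolded X.space_eq_univ])
    also have "\<dots> = 0" by (simp add: F' cdf_def)
    finally show "(\<integral>x. \<phi> x z \<partial>\<mu>) = 0" by (simp add: \<phi>_def)
  qed
  finally show ?thesis by (simp add: \<phi>_def)
qed

text \<open>
  A vertical or horizontal line is a Lebesgue null set, so neither marginal has atoms.
\<close>

lemma continuous_cdf_of_absolutely_continuous_marginal:
  fixes N :: "(real \<times> real) measure" and pr :: "real \<times> real \<Rightarrow> real"
  assumes N: "prob_space N" "sets N = sets borel" "absolutely_continuous lborel N" and pr: "pr \<in> {fst, snd}"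
  shows "continuous_on UNIV (cdf (distr N borel pr))"
proof -
  have [measurable_cong]: "sets N = sets borel" by fact
  have [measurable]: "pr \<in> borel_measurable borel"
    using pr by (auto simp: borel_prod[symmetric])
  interpret real_distribution "distr N borel pr"
    by (rule prob_space.real_distribution_distr[OF N(1)]) simp
  have "measure (distr N borel pr) {t} = 0" for t
  proof -
    have sp: "space N = UNIV" using sets_eq_imp_space_eq[OF N(2)] by simp
    have "pr -` {t} = {t} \<times> UNIV \<or> pr -` {t} = UNIV \<times> {t}"
      using pr by auto
    moreover have "emeasure (lborel \<Otimes>\<^sub>M lborel) ({t} \<times> (UNIV::real set)) = 0" "emeasure (lborel \<Otimes>\<^sub>M lborel) ((UNIV::real set) \<times> {t}) = 0"
      by (simp_all add: lborel.emeasure_pair_measure_Times)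
    ultimately have "pr -` {t} \<in> null_sets lborel"
      by (auto simp: null_sets_def lborel_prod borel_prod[symmetric])
    then have "pr -` {t} \<in> null_sets N"
      using N(3) by (auto simp: absolutely_continuous_def)
    then show ?thesis by (simp add: measure_distr sp measure_eq_0_null_sets)
  qed
  then show ?thesis by (simp add: continuous_on_eq_continuous_at isCont_cdf)
qed

text \<open>
  The strip \<open>a < u \<le> b\<close> contains the rectangle \<open>{a<..<c} \<times> {c<..<b}\<close> with \<open>c\<close> the midpoint of
  \<open>a\<close> and \<open>b\<close>.  It lies inside \<open>obs_domain M\<close>, where the density is positive, so its mass is positive.
\<close>

lemma strict_mono_on_cdf_marginal:
  fixes f :: "real \<times> real \<Rightarrow> ennreal"
  assumes f [measurable]: "f \<in> borel_measurable lborel" and N: "prob_space (density lborel f)"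
    and pos: "\<And>p. p \<in> obs_domain M \<Longrightarrow> f p > 0"
  shows "strict_mono_on {0..M} (cdf (distr (density lborel f) borel fst))"
proof (rule strict_mono_onI)
  fix a b assume ab: "a \<in> {0..M}" "b \<in> {0..M}" "a < b"
  define N where "N = density lborel f"
  interpret N: prob_space N using N by (simp add: N_def)
  have [measurable]: "fst \<in> borel_measurable (borel :: (real \<times> real) measure)"
    by (auto simp: borel_prod[symmetric])
  have [measurable_cong]: "sets N = sets borel" by (simp add: N_def)
  have sp: "space N = UNIV" by (simp add: N_def)
  interpret D: real_distribution "distr N borel fst"
    by (rule N.real_distribution_distr) simp
  define c where "c = (a + b) / 2"
  have c: "a < c" "c < b" using ab by (auto simp: c_def)
  define S where "S = {a<..<c} \<times> {c<..<b}"
  have "S \<notin> null_sets N"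
  proof
    assume "S \<in> null_sets N"
    then have "AE p in lborel. p \<in> S \<longrightarrow> f p = 0"
      by (simp add: N_def null_sets_density_iff)
    moreover have "f p \<noteq> 0" if "p \<in> S" for p
      using that ab c pos[of p] by (auto simp: S_def obs_domain_def)
    ultimately have "AE p in lborel. p \<notin> S" by auto
    then have "emeasure lborel S = 0"
      by (subst (asm) AE_iff_null_sets[symmetric])
         (auto simp: S_def borel_prod[symmetric])
    moreover have "emeasure lborel S = ennreal (c - a) * ennreal (b - c)"
      unfolding S_def lborel_prod[symmetric]
      using c by (subst lborel.emeasure_pair_measure_Times) auto
    ultimately show False using c by (simp add: ennreal_mult[symmetric])
  qed
  moreover have "S \<in> sets N" by (auto simp: S_def N_def borel_prod[symmetric])
  ultimately have "0 < measure N S"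
    by (simp add: null_sets_def N.emeasure_eq_measure zero_less_measure_iff)
  also have "\<dots> \<le> measure N (fst -` {a<..b} \<inter> space N)"
    using c by (intro N.finite_measure_mono measurable_sets[of fst N borel]) (auto simp: S_def sp)
  also have "\<dots> = measure (distr N borel fst) {a<..b}"
    by (simp add: measure_distr)
  also have "\<dots> = cdf (distr N borel fst) b - cdf (distr N borel fst) a"
    using D.cdf_diff_eq[OF ab(3)] by simp
  finally show "cdf (distr (density lborel f) borel fst) a < cdf (distr (density lborel f) borel fst) b"
    by (simp add: N_def)
qed

lemma distribution_function_with_density_on_Icc:
  assumes F: "distribution_function F" and f: "has_density_on F f {0..M}"
    and [measurable]: "(\<lambda>x. ennreal (f x * indicator {0..M} x)) \<in> borel_measurable lborel"
  shows "continuous_on UNIV F" "t \<le> 0 \<Longrightarrow> F t = 0" "t \<ge> M \<Longrightarrow> F t = 1"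
proof -
  define \<mu> where "\<mu> = interval_measure F"
  have \<mu>: "\<mu> = density lborel (\<lambda>x. ennreal (f x * indicator {0..M} x))"
    using f by (simp add: \<mu>_def has_density_on_def)
  have F': "\<And>x y. x \<le> y \<Longrightarrow> F x \<le> F y" "\<And>a. continuous (at_right a) F" "(F \<longlongrightarrow> 0) at_bot" "(F \<longlongrightarrow> 1) at_top"
    using F by (auto simp: distribution_function_def mono_def)
  interpret real_distribution \<mu>
    unfolding \<mu>_def by (rule real_distribution_interval_measure) (fact F')+
  have cdf: "F = cdf \<mu>"
    unfolding \<mu>_def by (rule cdf_interval_measure[symmetric]) (fact F')+
  have atom: "measure \<mu> {x} = 0" for x
  proof -
    have "AE y in lborel. y \<in> {x} \<longrightarrow> ennreal (f y * indicator {0..M} y) = 0"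
      using AE_lborel_singleton[of x] by eventually_elim auto
    then have "{x} \<in> null_sets \<mu>" by (simp add: \<mu> null_sets_density_iff)
    then show ?thesis by (rule measure_eq_0_null_sets)
  qed
  then show "continuous_on UNIV F"
    by (simp add: cdf continuous_on_eq_continuous_at isCont_cdf)
  show "F t = 0" if "t \<le> 0"
  proof -
    have "AE y in lborel. y \<in> {..t} \<longrightarrow> ennreal (f y * indicator {0..M} y) = 0"
      using AE_lborel_singleton[of 0] by eventually_elim (use that in auto)
    then have "{..t} \<in> null_sets \<mu>" by (simp add: \<mu> null_sets_density_iff)
    then show ?thesis by (simp add: cdf cdf_def measure_eq_0_null_sets)
  qed
  show "F t = 1" if "t \<ge> M"
  proof -
    have "{t<..} \<in> null_sets \<mu>" using that by (auto simp: \<mu> null_sets_density_iff)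
    then have "measure \<mu> {t<..} = 0" by (rule measure_eq_0_null_sets)
    moreover have "- {..t} = {t<..}" by auto
    ultimately show ?thesis using prob_compl[of "{..t}"] by (simp add: cdf cdf_def Compl_eq_Diff_UNIV)
  qed
qed

section \<open>Strong uniform consistency\<close>

theorem lemma3:
  fixes M :: real
    and F0 f0 :: "real \<Rightarrow> real"
    and h :: "real \<times> real \<Rightarrow> real"
    and P :: "'a measure"
    and X U V :: "nat \<Rightarrow> 'a \<Rightarrow> real"
    and Fhat :: "nat \<Rightarrow> 'a \<Rightarrow> real \<Rightarrow> real"
  assumes "M > 0"
    and "distribution_function F0"
    and "has_density_on F0 f0 {0..M}"
    and "continuous_on {0..M} f0"
    and "\<And>x. x \<in> {0..M} \<Longrightarrow> f0 x > 0"
    and "stays_away_from_zero_on f0 {0..M}"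
    and "continuous_on (obs_domain M) h"
    and "\<And>p. p \<in> obs_domain M \<Longrightarrow> h p > 0"
    and "stays_away_from_zero_on h (obs_domain M)"
    and "bounded_partial_derivatives_on h (obs_domain M)"
    and "prob_space P"
    and "prob_space.indep_vars P (\<lambda>_. borel) (\<lambda>i \<omega>. (X i \<omega>, U i \<omega>, V i \<omega>)) {1..}"
    and "\<And>i. i \<ge> 1 \<Longrightarrow> cdf (distr P borel (X i)) = F0"
    and "\<And>i. i \<ge> 1 \<Longrightarrow> distributed P lborel (\<lambda>\<omega>. (U i \<omega>, V i \<omega>))
            (\<lambda>p. ennreal (h p * indicator (obs_domain M) p))"
    and "\<And>i. i \<ge> 1 \<Longrightarrow> indep_rv P borel (X i) borel (\<lambda>\<omega>. (U i \<omega>, V i \<omega>))"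
    and "\<And>n \<omega>. n \<ge> 1 \<Longrightarrow> \<omega> \<in> space P \<Longrightarrow>
            isotonic_lse n (\<lambda>i. X i \<omega>) (\<lambda>i. U i \<omega>) (\<lambda>i. V i \<omega>) (Fhat n \<omega>)"
  shows "AE \<omega> in P. (\<lambda>n. SUP t. \<bar>Fhat n \<omega> t - F0 t\<bar>) \<longlonglongrightarrow> 0"
proof -
  interpret P: prob_space P by fact
  define Z where "Z i \<omega> = (U i \<omega>, V i \<omega>)" for i \<omega>
  define f where "f p = ennreal (h p * indicator (obs_domain M) p)" for p
  define N where "N = density lborel f"
  note indep = assms(12)
  have distr: "distr P borel (Z i) = N" and Z [measurable]: "Z i \<in> borel_measurable P"
    and f [measurable]: "f \<in> borel_measurable lborel"
    if "i \<ge> 1" for i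
    using assms(14)[OF that] unfolding distributed_def N_def Z_def[abs_def] f_def[abs_def]
    by (auto cong: distr_cong)
  have f: "f \<in> borel_measurable lborel" using f[of 1] by simp
  have N: "prob_space N" using P.prob_space_distr[OF Z[of 1]] distr[of 1] by simp
  have [measurable]: "fst \<in> borel_measurable (borel :: (real \<times> real) measure)"
      "snd \<in> borel_measurable (borel :: (real \<times> real) measure)"
    by (auto simp: borel_prod[symmetric])
  have pr_meas [measurable]: "pr \<in> borel_measurable borel" if "pr \<in> {fst, snd}" for pr :: "real \<times> real \<Rightarrow> real"
    using that by auto
  define \<Phi> where "\<Phi> pr = cdf (distr N borel pr)" for pr
  have cont: "continuous_on UNIV (\<Phi> pr)" if "pr \<in> {fst, snd}" for pr
    unfolding \<Phi>_def
    by (rule continuous_cdf_of_absolutely_continuous_marginal[OF N _ _ that])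
       (use absolutely_continuousI_density[OF f] in \<open>simp_all add: N_def\<close>)
  have strict: "strict_mono_on {0..M} (\<Phi> fst)"
    unfolding \<Phi>_def N_def
    by (rule strict_mono_on_cdf_marginal[OF f]) (use N assms(8) in \<open>auto simp: N_def f_def\<close>)
  have F0_meas: "(\<lambda>x. ennreal (f0 x * indicator {0..M} x)) \<in> borel_measurable lborel"
  proof -
    have "(\<lambda>x. indicator {0..M} x *\<^sub>R f0 x) \<in> borel_measurable borel"
      using assms(4) by (intro borel_measurable_continuous_on_indicator) auto
    then show ?thesis by (simp add: mult.commute)
  qed
  note F0 = distribution_function_with_density_on_Icc[OF assms(2,3) F0_meas]
  have F0_borel [measurable]: "F0 \<in> borel_measurable borel"
    using F0(1) by (rule borel_measurable_continuous_onI)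
  have slln: "AE \<omega> in P. sample_mean (\<lambda>i. \<phi> (X i \<omega>) (Z i \<omega>)) \<longlonglongrightarrow> \<mu>"
    if [measurable]: "(\<lambda>(x, z). \<phi> x z) \<in> borel_measurable (borel \<Otimes>\<^sub>M borel)"
      and "\<And>x z. \<bar>\<phi> x z\<bar> \<le> 1" "\<And>i. i \<ge> 1 \<Longrightarrow> P.expectation (\<lambda>\<omega>. \<phi> (X i \<omega>) (Z i \<omega>)) = \<mu>"
    for \<phi> :: "real \<Rightarrow> real \<times> real \<Rightarrow> real" and \<mu>
  proof (rule P.strong_law_bounded[where B=1])
    have "(\<lambda>(x, z). \<phi> x z) \<in> borel_measurable borel"
      using that(1) by (simp add: borel_prod)
    from P.indep_vars_compose2[OF indep, of "\<lambda>_. \<lambda>(x, z). \<phi> x z" "\<lambda>_. borel"] this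
    show "P.indep_vars (\<lambda>_. borel) (\<lambda>i \<omega>. \<phi> (X i \<omega>) (Z i \<omega>)) {1..}"
      by (simp add: Z_def)
    show "\<bar>\<phi> (X i \<omega>) (Z i \<omega>)\<bar> \<le> 1" for i \<omega>
      by (rule that(2))
    show "P.expectation (\<lambda>\<omega>. \<phi> (X i \<omega>) (Z i \<omega>)) = \<mu>" if "i \<ge> 1" for i
      using \<open>\<And>i. i \<ge> 1 \<Longrightarrow> P.expectation (\<lambda>\<omega>. \<phi> (X i \<omega>) (Z i \<omega>)) = \<mu>\<close> that by blast
  qed
  have freq: "AE \<omega> in P. sample_mean (\<lambda>i. indicator {a<..b} (pr (Z i \<omega>))) \<longlonglongrightarrow> \<Phi> pr b - \<Phi> pr a"
    if pr: "pr \<in> {fst, snd}" and ab: "a \<le> b" for pr a b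
  proof (rule slln)
    note [measurable] = pr_meas[OF pr]
    interpret D: real_distribution "distr N borel pr"
      by (rule prob_space.real_distribution_distr[OF N]) (simp add: N_def)
    fix i :: nat assume i: "i \<ge> 1"
    note [measurable] = Z[OF i]
    have "P.expectation (\<lambda>\<omega>. indicator {a<..b} (pr (Z i \<omega>))) = measure P ((\<lambda>\<omega>. pr (Z i \<omega>)) -` {a<..b} \<inter> space P)"
      by (subst Bochner_Integration.integral_cong[OF refl, of _ _ "indicator ((\<lambda>\<omega>. pr (Z i \<omega>)) -` {a<..b} \<inter> space P)"])
         (auto simp: indicator_def)
    also have "\<dots> = measure (distr P borel (\<lambda>\<omega>. pr (Z i \<omega>))) {a<..b}"
      by (simp add: measure_distr)
    also have "distr P borel (\<lambda>\<omega>. pr (Z i \<omega>)) = distr N borel pr"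
      unfolding distr[OF i, symmetric] by (subst distr_distr) (auto simp: comp_def)
    also have "measure (distr N borel pr) {a<..b} = \<Phi> pr b - \<Phi> pr a"
      using D.cdf_diff_eq[of a b] ab by (cases "a = b") (auto simp: \<Phi>_def)
    finally show "P.expectation (\<lambda>\<omega>. indicator {a<..b} (pr (Z i \<omega>))) = \<Phi> pr b - \<Phi> pr a" .
  qed (use pr_meas[OF pr] in \<open>auto simp: indicator_def\<close>)
  have orth: "AE \<omega> in P. sample_mean (\<lambda>i. indicator {a<..b} (pr (Z i \<omega>)) * residual F0 (X i \<omega>) (pr' (Z i \<omega>))) \<longlonglongrightarrow> 0"
    if pr: "pr \<in> {fst, snd}" "pr' \<in> {fst, snd}" for pr pr' a b
  proof (rule slln)
    note [measurable] = pr_meas[OF pr(1)] pr_meas[OF pr(2)]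
    show "(\<lambda>(x, z). indicator {a<..b} (pr z) * residual F0 x (pr' z)) \<in> borel_measurable (borel \<Otimes>\<^sub>M borel)"
      unfolding residual_def by measurable
    show "\<bar>indicator {a<..b} (pr z) * residual F0 x (pr' z)\<bar> \<le> 1" for x z
      using distribution_function_range[OF assms(2), of "pr' z"] by (auto simp: residual_def indicator_def)
    show "P.expectation (\<lambda>\<omega>. indicator {a<..b} (pr (Z i \<omega>)) * residual F0 (X i \<omega>) (pr' (Z i \<omega>))) = 0"
      if i: "i \<ge> 1" for i
      using assms(15)[OF i]
      by (intro P.expectation_weighted_residual_eq_0[where T=borel and B=1 and g=pr' and w="\<lambda>z. indicator {a<..b} (pr z)"] assms(13)[OF i])
         (auto simp: Z_def[abs_def] indicator_def)
  qed
  have dom: "AE \<omega> in P. Z i \<omega> \<in> obs_domain M" if i: "i \<ge> 1" for i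
  proof -
    have "AE p in N. p \<in> obs_domain M"
      unfolding N_def AE_density[OF f] by (auto simp: f_def indicator_def)
    then show ?thesis
      unfolding distr[OF i, symmetric] by (rule AE_distrD[OF Z[OF i]])
  qed
  (* Rational end points keep the exceptional events countable in number, so that outside a single
     null set the sample can be treated deterministically. *)
  have "AE \<omega> in P. \<forall>i\<in>{1..}. Z i \<omega> \<in> obs_domain M"
    by (rule AE_ball_countable') (use dom in auto)
  moreover have "AE \<omega> in P. \<forall>pr\<in>{fst,snd}. \<forall>a\<in>\<rat>. \<forall>b\<in>\<rat>. a \<le> b \<longrightarrow>
      sample_mean (\<lambda>i. indicator {a<..b} (pr (Z i \<omega>))) \<longlonglongrightarrow> \<Phi> pr b - \<Phi> pr a"
    by (intro AE_ball_countable' AE_impI freq countable_rat) auto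
  moreover have "AE \<omega> in P. \<forall>pr\<in>{fst,snd}. \<forall>pr'\<in>{fst,snd}. \<forall>a\<in>\<rat>. \<forall>b\<in>\<rat>.
      sample_mean (\<lambda>i. indicator {a<..b} (pr (Z i \<omega>)) * residual F0 (X i \<omega>) (pr' (Z i \<omega>))) \<longlonglongrightarrow> 0"
    by (intro AE_ball_countable' orth countable_rat) auto
  ultimately show ?thesis
    using AE_space
  proof eventually_elim
    case (elim \<omega>)
    have "uniform_limit UNIV (\<lambda>n. Fhat n \<omega>) F0 sequentially"
    proof (rule lse_uniformly_consistent_on_regular_samples[where \<Phi>="\<Phi> fst" and \<Psi>="\<Phi> snd"
          and u="\<lambda>i. U i \<omega>" and v="\<lambda>i. V i \<omega>" and x="\<lambda>i. X i \<omega>" and M=M])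
      show "isotonic_lse n (\<lambda>i. X i \<omega>) (\<lambda>i. U i \<omega>) (\<lambda>i. V i \<omega>) (Fhat n \<omega>)" if "n \<ge> 1" for n
        using assms(16) that elim by simp
      show "sample_mean (\<lambda>i. indicator {a<..b} (s i) * residual F0 (X i \<omega>) (t i)) \<longlonglongrightarrow> 0"
        if "a \<in> \<rat>" "b \<in> \<rat>" "s \<in> {\<lambda>i. U i \<omega>, \<lambda>i. V i \<omega>}" "t \<in> {\<lambda>i. U i \<omega>, \<lambda>i. V i \<omega>}" for a b s t
        using elim(3) that by (auto simp: Z_def)
    qed (use elim assms F0 cont strict in \<open>auto simp: Z_def\<close>)
    then show ?case by (rule SUP_abs_diff_tendsto_0)
  qed
qed

end
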